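(* Let $p(\vartheta,x)$ be a joint probability density of $(\vartheta,x)\in\mathbf{\Theta}\times\mathbf{X}$ with marginal densities $p(\vartheta)$ and $p(x)$, and let $d(\vartheta,x)=\dfrac{p(\vartheta,x)}{p(\vartheta,x)+p(\vartheta)p(x)}$. Let $\hat d:\mathbf{\Theta}\times\mathbf{X}\to[0,1]$ be any (measurable) classifier that is balanced, i.e. $$\mathbb{E}_{p(\vartheta,x)}\left[\hat d(\vartheta,x)\right]+\mathbb{E}_{p(\vartheta)p(x)}\left[\hat d(\vartheta,x)\right]=1.$$ Then $$\mathbb{E}_{p(\vartheta)p(x)}\left[\frac{1-d(\vartheta,x)}{1-\hat d(\vartheta,x)}\right]\ge 1.$$
   Context: $\mathbf{\Theta}$ (parameter space) and $\mathbf{X}$ (observation space) are measurable spaces equipped with $\sigma$-finite reference measures (e.g. Lebesgue measure on Euclidean spaces), written $\mathrm{d}\vartheta$ and $\mathrm{d}x$. $p(\vartheta,x)$ is a probability density with respect to the product reference measure, and $p(\vartheta)=\int p(\vartheta,x)\,\mathrm{d}x$, $p(x)=\int p(\vartheta,x)\,\mathrm{d}\vartheta$ are its marginals. For a function $g$, $\mathbb{E}_{p(\vartheta,x)}[g]=\iint g(\vartheta,x)\,p(\vartheta,x)\,\mathrm{d}\vartheta\,\mathrm{d}x$ and $\mathbb{E}_{p(\vartheta)p(x)}[g]=\iint g(\vartheta,x)\,p(\vartheta)p(x)\,\mathrm{d}\vartheta\,\mathrm{d}x$. The function $d$ (the Bayes optimal classifier for distinguishing samples of $p(\vartheta,x)$,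 label 1, from samples of $p(\vartheta)p(x)$, label 0) is defined by its formula wherever the denominator is positive; its values elsewhere are irrelevant, since both $p(\vartheta,x)$ and $p(\vartheta)p(x)$ vanish there. The expectation in the conclusion is of a nonnegative function and takes values in $[0,+\infty]$, with the convention $a/0=+\infty$ for $a>0$. *)

theory Defs
  imports "HOL-Analysis.Analysis"
begin

(* Where the defining integral diverges, which happens only on a null set if p is a
   probability density, the Bochner integral is 0. *)
definition marginal_theta :: "'b measure \<Rightarrow> ('a \<times> 'b \<Rightarrow> real) \<Rightarrow> 'a \<Rightarrow> real" where
  "marginal_theta X p \<theta> = (\<integral>x. p (\<theta>, x) \<partial>X)"

definition marginal_x :: "'a measure \<Rightarrow> ('a \<times> 'b \<Rightarrow> real) \<Rightarrow> 'b \<Rightarrow> real" where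
  "marginal_x \<Theta> p x = (\<integral>\<theta>. p (\<theta>, x) \<partial>\<Theta>)"

definition prod_marginals ::
    "'a measure \<Rightarrow> 'b measure \<Rightarrow> ('a \<times> 'b \<Rightarrow> real) \<Rightarrow> 'a \<times> 'b \<Rightarrow> real" where
  "prod_marginals \<Theta> X p = (\<lambda>(\<theta>, x). marginal_theta X p \<theta> * marginal_x \<Theta> p x)"

definition is_prob_density :: "'c measure \<Rightarrow> ('c \<Rightarrow> real) \<Rightarrow> bool" where
  "is_prob_density M q \<longleftrightarrow>
     q \<in> borel_measurable M \<and> (\<forall>z\<in>space M. 0 \<le> q z) \<and> (\<integral>\<^sup>+z. ennreal (q z) \<partial>M) = 1"

(* Expectation, with values in [0,\<infinity>], of a nonnegative function g under the density q with
   respect to the reference measure M. In ennreal, \<infinity> * 0 = 0, so the values of g where q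
   vanishes do not matter. *)
definition expect :: "'c measure \<Rightarrow> ('c \<Rightarrow> real) \<Rightarrow> ('c \<Rightarrow> ennreal) \<Rightarrow> ennreal" where
  "expect M q g = (\<integral>\<^sup>+z. g z * ennreal (q z) \<partial>M)"

(* Where the denominator vanishes, so do p and the product of its marginals; the value 0
   given there by real division plays no role. *)
definition bayes_classifier ::
    "'a measure \<Rightarrow> 'b measure \<Rightarrow> ('a \<times> 'b \<Rightarrow> real) \<Rightarrow> 'a \<times> 'b \<Rightarrow> real" where
  "bayes_classifier \<Theta> X p z = p z / (p z + prod_marginals \<Theta> X p z)"

definition balanced ::
    "'a measure \<Rightarrow> 'b measure \<Rightarrow> ('a \<times> 'b \<Rightarrow> real) \<Rightarrow> ('a \<times> 'b \<Rightarrow> real) \<Rightarrow> bool" where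
  "balanced \<Theta> X p d' \<longleftrightarrow>
     expect (\<Theta> \<Otimes>\<^sub>M X) p (\<lambda>z. ennreal (d' z))
     + expect (\<Theta> \<Otimes>\<^sub>M X) (prod_marginals \<Theta> X p) (\<lambda>z. ennreal (d' z)) = 1"

end

(* With q the product of the marginals and m = p + q, balance says that the weight
   m (1 - d_hat) has total mass 2 - 1 = 1, while the quantity to be bounded is the integral of
   q^2 / (m (1 - d_hat)).  The bound therefore follows by integrating a^2 / b \<ge> 2 a - b. *)
theory Submission
  imports Defs
begin

text \<open>Tonelli turns the total mass 1 into an iterated integral. On almost every slice the
  inner integral is finite, and there the Bochner integral defining the marginal has the same
  value.\<close>

lemma prob_density_marginal_theta:
  fixes \<Theta> :: "'a measure" and X :: "'b measure" and p :: "'a \<times> 'b \<Rightarrow> real"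
  assumes "sigma_finite_measure X" and p: "is_prob_density (\<Theta> \<Otimes>\<^sub>M X) p"
  shows "is_prob_density \<Theta> (marginal_theta X p)"
proof -
  interpret X: sigma_finite_measure X by fact
  have meas [measurable]: "p \<in> borel_measurable (\<Theta> \<Otimes>\<^sub>M X)"
    and nonneg: "\<And>\<theta> x. \<theta> \<in> space \<Theta> \<Longrightarrow> x \<in> space X \<Longrightarrow> 0 \<le> p (\<theta>, x)"
    and one: "(\<integral>\<^sup>+z. ennreal (p z) \<partial>(\<Theta> \<Otimes>\<^sub>M X)) = 1"
    using p by (auto simp: is_prob_density_def space_pair_measure)
  have iter: "(\<integral>\<^sup>+\<theta>. \<integral>\<^sup>+x. ennreal (p (\<theta>, x)) \<partial>X \<partial>\<Theta>) = 1"
    using X.nn_integral_fst[of "\<lambda>z. ennreal (p z)" \<Theta>] one by simp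
  \<comment> \<open>A divergent slice would have Bochner integral 0 but nonnegative integral
    infinity. Since the iterated integral is finite, such slices form a null set.\<close>
  have "AE \<theta> in \<Theta>. (\<integral>\<^sup>+x. ennreal (p (\<theta>, x)) \<partial>X) \<noteq> \<infinity>"
    by (rule nn_integral_PInf_AE) (simp_all add: iter)
  then have "AE \<theta> in \<Theta>. ennreal (marginal_theta X p \<theta>) = (\<integral>\<^sup>+x. ennreal (p (\<theta>, x)) \<partial>X)"
  proof (rule AE_mp, intro AE_I2 impI)
    fix \<theta> assume \<theta> [measurable]: "\<theta> \<in> space \<Theta>"
      and fin: "(\<integral>\<^sup>+x. ennreal (p (\<theta>, x)) \<partial>X) \<noteq> \<infinity>"
    have AE: "AE x in X. 0 \<le> p (\<theta>, x)"
      using nonneg \<theta> by (intro AE_I2) auto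
    have "integrable X (\<lambda>x. p (\<theta>, x))"
      using fin AE by (intro integrableI_nonneg) (auto simp: top.not_eq_extremum)
    then show "ennreal (marginal_theta X p \<theta>) = (\<integral>\<^sup>+x. ennreal (p (\<theta>, x)) \<partial>X)"
      unfolding marginal_theta_def using AE by (simp add: nn_integral_eq_integral)
  qed
  then have "(\<integral>\<^sup>+\<theta>. ennreal (marginal_theta X p \<theta>) \<partial>\<Theta>) = 1"
    using iter by (simp cong: nn_integral_cong_AE)
  moreover have "marginal_theta X p \<in> borel_measurable \<Theta>"
    unfolding marginal_theta_def by measurable
  moreover have "\<forall>\<theta>\<in>space \<Theta>. 0 \<le> marginal_theta X p \<theta>"
    unfolding marginal_theta_def using nonneg by (auto intro!: Bochner_Integration.integral_nonneg)
  ultimately show ?thesis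
    by (simp add: is_prob_density_def)
qed

text \<open>The coordinate swap carries one product measure to the other. This lets the result on
  the first marginal serve for the second.\<close>

lemma prob_density_swap:
  fixes \<Theta> :: "'a measure" and X :: "'b measure" and p :: "'a \<times> 'b \<Rightarrow> real"
  assumes "sigma_finite_measure \<Theta>" and "sigma_finite_measure X"
    and p: "is_prob_density (\<Theta> \<Otimes>\<^sub>M X) p"
  shows "is_prob_density (X \<Otimes>\<^sub>M \<Theta>) (\<lambda>(x, \<theta>). p (\<theta>, x))"
proof -
  interpret pair_sigma_finite \<Theta> X
    using assms(1,2) by (simp add: pair_sigma_finite_def)
  have meas [measurable]: "p \<in> borel_measurable (\<Theta> \<Otimes>\<^sub>M X)"
    using p by (simp add: is_prob_density_def)
  have "(\<integral>\<^sup>+z. ennreal (p z) \<partial>(\<Theta> \<Otimes>\<^sub>M X))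
      = (\<integral>\<^sup>+z. ennreal (case z of (x, \<theta>) \<Rightarrow> p (\<theta>, x)) \<partial>(X \<Otimes>\<^sub>M \<Theta>))"
    by (subst distr_pair_swap) (simp add: nn_integral_distr split_beta)
  with p show ?thesis
    by (auto simp: is_prob_density_def space_pair_measure)
qed

lemma prob_density_marginal_x:
  fixes \<Theta> :: "'a measure" and X :: "'b measure" and p :: "'a \<times> 'b \<Rightarrow> real"
  assumes "sigma_finite_measure \<Theta>" and "sigma_finite_measure X"
    and "is_prob_density (\<Theta> \<Otimes>\<^sub>M X) p"
  shows "is_prob_density X (marginal_x \<Theta> p)"
proof -
  have "marginal_x \<Theta> p = marginal_theta \<Theta> (\<lambda>(x, \<theta>). p (\<theta>, x))"
    by (simp add: fun_eq_iff marginal_x_def marginal_theta_def)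
  then show ?thesis
    using prob_density_marginal_theta[OF assms(1) prob_density_swap[OF assms]] by simp
qed

lemma prob_density_times:
  fixes f :: "'a \<Rightarrow> real" and g :: "'b \<Rightarrow> real"
  assumes "sigma_finite_measure N" and f: "is_prob_density M f" and g: "is_prob_density N g"
  shows "is_prob_density (M \<Otimes>\<^sub>M N) (\<lambda>(x, y). f x * g y)"
proof -
  interpret N: sigma_finite_measure N by fact
  have [measurable]: "f \<in> borel_measurable M" "g \<in> borel_measurable N"
    and nonneg: "\<And>x. x \<in> space M \<Longrightarrow> 0 \<le> f x" "\<And>y. y \<in> space N \<Longrightarrow> 0 \<le> g y"
    and one: "(\<integral>\<^sup>+x. ennreal (f x) \<partial>M) = 1" "(\<integral>\<^sup>+y. ennreal (g y) \<partial>N) = 1"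
    using f g by (auto simp: is_prob_density_def)
  have "(\<integral>\<^sup>+z. ennreal (case z of (x, y) \<Rightarrow> f x * g y) \<partial>(M \<Otimes>\<^sub>M N))
      = (\<integral>\<^sup>+x. \<integral>\<^sup>+y. ennreal (f x * g y) \<partial>N \<partial>M)"
    by (subst N.nn_integral_fst[symmetric]) simp_all
  \<comment> \<open>\<open>ennreal\<close> sends negative reals to 0, so splitting the product
    relies on the signs of \<open>f\<close> and \<open>g\<close>, which are known only on the
    spaces.\<close>
  also have "\<dots> = (\<integral>\<^sup>+x. \<integral>\<^sup>+y. ennreal (f x) * ennreal (g y) \<partial>N \<partial>M)"
    using nonneg by (intro nn_integral_cong) (simp add: ennreal_mult)
  also have "\<dots> = 1"
    using one by (simp add: nn_integral_cmult)
  finally show ?thesis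
    using nonneg by (auto simp: is_prob_density_def space_pair_measure)
qed

lemma prob_density_prod_marginals:
  fixes \<Theta> :: "'a measure" and X :: "'b measure" and p :: "'a \<times> 'b \<Rightarrow> real"
  assumes "sigma_finite_measure \<Theta>" and "sigma_finite_measure X"
    and "is_prob_density (\<Theta> \<Otimes>\<^sub>M X) p"
  shows "is_prob_density (\<Theta> \<Otimes>\<^sub>M X) (prod_marginals \<Theta> X p)"
  unfolding prod_marginals_def
  by (intro prob_density_times prob_density_marginal_theta prob_density_marginal_x assms)

text \<open>This is a^2 / b \<ge> 2 a - b with a = \<open>q\<close> and b =
  \<open>(p + q) * (1 - h)\<close>, because 1 - \<open>p / (p + q)\<close> is
  \<open>q / (p + q)\<close>. The term b is moved to the right since subtraction in
  \<open>ennreal\<close> truncates.\<close>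

lemma two_mult_le_ratio_plus:
  fixes p q h :: real
  assumes "0 \<le> p" "0 \<le> q" "h \<le> 1"
  shows "2 * ennreal q
    \<le> ennreal (1 - p / (p + q)) / ennreal (1 - h) * ennreal q + ennreal ((p + q) * (1 - h))"
\<comment> \<open>For \<open>q = 0\<close> the left side is 0. Otherwise \<open>p + q\<close> is
  positive and the quotient has its usual meaning.\<close>
proof (cases "q = 0")
  case True
  then show ?thesis by simp
next
  case False
  with assms have q: "0 < q" and m: "0 < p + q" by auto
  have d: "1 - p / (p + q) = q / (p + q)"
    using m by (simp add: field_simps)
  show ?thesis
  proof (cases "h = 1")
    case True
    \<comment> \<open>A positive numerator over 0 is infinity in \<open>ennreal\<close>, and it
      stays infinite after multiplication by \<open>q > 0\<close>.\<close>
    have "ennreal (q / (p + q)) \<noteq> 0"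
      using q m by (simp add: ennreal_eq_0_iff not_le)
    then have "ennreal (1 - p / (p + q)) / ennreal (1 - h) * ennreal q = \<infinity>"
      using q True by (simp add: d ennreal_top_mult ennreal_eq_0_iff not_le ennreal_divide_zero)
    then show ?thesis by simp
  next
    case False
    define b where "b = (p + q) * (1 - h)"
    have h: "0 < 1 - h" and b: "0 < b"
      using False assms m by (auto simp: b_def)
    \<comment> \<open>Expanding the square gives q^2 / b - 2 q + b \<ge> 0.\<close>
    have "0 \<le> (q - b)\<^sup>2 / b"
      using b by simp
    then have "2 * q \<le> q / b * q + b"
      using b by (simp add: power2_eq_square field_simps)
    then have "ennreal (2 * q) \<le> ennreal (q / b * q + b)"
      by (rule ennreal_leI)
    also have "\<dots> = ennreal (q / b) * ennreal q + ennreal b"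
      using q b by (simp add: ennreal_mult del: times_divide_eq_left)
    also have "ennreal (q / b) = ennreal (1 - p / (p + q)) / ennreal (1 - h)"
      using q m h by (simp add: d b_def divide_ennreal)
    finally show ?thesis
      using q by (simp add: ennreal_mult b_def)
  qed
qed

(* The quotient is taken in ennreal, where a / 0 = \<infinity> for a > 0. *)
theorem theorem2:
  fixes \<Theta> :: "'a measure" and X :: "'b measure"
    and p d_hat :: "'a \<times> 'b \<Rightarrow> real"
  assumes "sigma_finite_measure \<Theta>" and "sigma_finite_measure X"
    and "is_prob_density (\<Theta> \<Otimes>\<^sub>M X) p"
    and "d_hat \<in> borel_measurable (\<Theta> \<Otimes>\<^sub>M X)"
    and "\<And>z. z \<in> space (\<Theta> \<Otimes>\<^sub>M X) \<Longrightarrow> d_hat z \<in> {0..1}"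
    and "balanced \<Theta> X p d_hat"
  shows "expect (\<Theta> \<Otimes>\<^sub>M X) (prod_marginals \<Theta> X p)
           (\<lambda>z. ennreal (1 - bayes_classifier \<Theta> X p z) / ennreal (1 - d_hat z)) \<ge> 1"
proof -
  define M where "M = \<Theta> \<Otimes>\<^sub>M X"
  define q where "q = prod_marginals \<Theta> X p"
  have q_density: "is_prob_density M q"
    unfolding M_def q_def by (intro prob_density_prod_marginals assms)
  have [measurable]: "p \<in> borel_measurable M" "q \<in> borel_measurable M" "d_hat \<in> borel_measurable M"
    and p0: "\<And>z. z \<in> space M \<Longrightarrow> 0 \<le> p z" and q0: "\<And>z. z \<in> space M \<Longrightarrow> 0 \<le> q z"
    and p1: "(\<integral>\<^sup>+z. ennreal (p z) \<partial>M) = 1" and q1: "(\<integral>\<^sup>+z. ennreal (q z) \<partial>M) = 1"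
    using assms(3,4) q_density by (auto simp: is_prob_density_def M_def)
  have h: "0 \<le> d_hat z" "d_hat z \<le> 1" if "z \<in> space M" for z
    using assms(5) that by (auto simp: M_def)
  let ?S = "\<integral>\<^sup>+z. ennreal ((p z + q z) * (1 - d_hat z)) \<partial>M"
  let ?ratio = "\<lambda>z. ennreal (1 - p z / (p z + q z)) / ennreal (1 - d_hat z) * ennreal (q z)"
  \<comment> \<open>Balance replaces the 1 by the two expectations of \<open>d_hat\<close>. Adding
    \<open>?S\<close> to them, instead of subtracting them from 2, avoids truncated
    subtraction.\<close>
  have "1 + ?S = (\<integral>\<^sup>+z. ennreal (d_hat z) * ennreal (p z) \<partial>M)
      + (\<integral>\<^sup>+z. ennreal (d_hat z) * ennreal (q z) \<partial>M) + ?S"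
    using assms(6) by (simp add: balanced_def expect_def M_def q_def)
  also have "\<dots> = (\<integral>\<^sup>+z. ennreal (d_hat z) * ennreal (p z) + ennreal (d_hat z) * ennreal (q z)
      + ennreal ((p z + q z) * (1 - d_hat z)) \<partial>M)"
    by (simp add: nn_integral_add)
  also have "\<dots> = (\<integral>\<^sup>+z. ennreal (p z) + ennreal (q z) \<partial>M)"
  proof (intro nn_integral_cong)
    fix z assume z: "z \<in> space M"
    \<comment> \<open>With all terms nonnegative the sum can be formed in the reals, where the
      weights \<open>d_hat z\<close> and \<open>1 - d_hat z\<close> on \<open>p z + q z\<close> add
      up to 1.\<close>
    have "0 \<le> (p z + q z) * (1 - d_hat z)"
      using p0 q0 h z by simp
    then have "ennreal (d_hat z) * ennreal (p z) + ennreal (d_hat z) * ennreal (q z)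
        + ennreal ((p z + q z) * (1 - d_hat z))
        = ennreal (d_hat z * p z + d_hat z * q z + (p z + q z) * (1 - d_hat z))"
      using p0 q0 h z by (simp add: ennreal_mult)
    also have "\<dots> = ennreal (p z + q z)"
      by (simp add: algebra_simps)
    finally show "ennreal (d_hat z) * ennreal (p z) + ennreal (d_hat z) * ennreal (q z)
        + ennreal ((p z + q z) * (1 - d_hat z)) = ennreal (p z) + ennreal (q z)"
      using p0 q0 z by simp
  qed
  also have "\<dots> = 1 + 1"
    by (simp add: nn_integral_add p1 q1)
  \<comment> \<open>The common summand 1 is finite, hence can be cancelled.\<close>
  finally have S: "?S = 1"
    using ennreal_add_left_cancel[of 1 ?S 1] by simp
  \<comment> \<open>The pointwise bound is integrated over \<open>M\<close>: its left side has mass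
    2, and of its right side the weight contributes \<open>?S\<close>, which is 1. Cancelling this 1
    leaves the claim.\<close>
  have "1 + 1 = (\<integral>\<^sup>+z. 2 * ennreal (q z) \<partial>M)"
    by (simp add: nn_integral_cmult q1)
  also have "\<dots> \<le> (\<integral>\<^sup>+z. ?ratio z + ennreal ((p z + q z) * (1 - d_hat z)) \<partial>M)"
    by (intro nn_integral_mono two_mult_le_ratio_plus p0 q0 h)
  also have "\<dots> = 1 + (\<integral>\<^sup>+z. ?ratio z \<partial>M)"
    by (simp add: nn_integral_add S add.commute)
  finally have "1 \<le> (\<integral>\<^sup>+z. ?ratio z \<partial>M)"
    using ennreal_add_left_cancel_le[of 1 1] by simp
  then show ?thesis
    by (simp add: expect_def bayes_classifier_def M_def q_def)
qed

end
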